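(* For each integer $d\geq 1$ let $\delta=2-\frac d2$ and let $\phi_d:\mathbb{R}^d\setminus\{0\}\to\mathbb{R}$ be the radial function $\phi_d(x)=r^{2-d}e^{-r^2/2}Ei^{(\delta)}(r^2/2)$, where $r=\Vert x\Vert$. Then: (i) $\phi_1$ is integrable on $\mathbb{R}$, i.e. $\phi_1\in L^1(\mathbb{R})$; (ii) $\phi_2\in L^2(\mathbb{R}^2)$ and $\phi_3\in L^2(\mathbb{R}^3)$; (iii) for every $d\geq 4$, $\phi_d$ does not belong to $L^p(\mathbb{R}^d)$ for any $1\leq p\leq\infty$, but $\phi_d$ defines a tempered distribution, i.e. for every $\varphi$ in the Schwartz space $\mathcal{S}(\mathbb{R}^d)$ the function $\phi_d\varphi$ is integrable, and $\varphi\mapsto\int_{\mathbb{R}^d}\phi_d(x)\varphi(x)\,dx$ is a continuous linear form on $\mathcal{S}(\mathbb{R}^d)$.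
   Context: For a real number $\delta<2$ and $x>0$, the $\delta$-exponential function is $$Ei^{(\delta)}(x)=\int_{-\infty}^x\frac{e^t}{t^\delta}\,dt,$$ where, for $t<0$, $t^\delta$ means $-|t|^\delta$ (this convention is used for every $\delta<2$, including $\delta=0$ and negative $\delta$). For $\delta<1$ the integrand is integrable; for $1\leq\delta<2$ the integral is interpreted as the principal value $$Ei^{(\delta)}(x)=\lim_{\epsilon\to0^+}\left\{\int_{-\infty}^{-\epsilon}+\int_\epsilon^x\right\}\frac{e^t}{t^\delta}\,dt .$$ Here $\Vert x\Vert^2=x_1^2+\cdots+x_d^2$, and $L^p(\mathbb{R}^d)$ is taken with respect to Lebesgue measure. *)

theory Defs
  imports "HOL-Analysis.Analysis"
begin

text \<open>Signed power: $t^\delta = -|t|^\delta$ for $t < 0$, for every real exponent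
  (so the value at negative $t$ is $-1$ for $\delta = 0$).\<close>

definition signed_powr :: "real \<Rightarrow> real \<Rightarrow> real" where
  "signed_powr t \<delta> = sgn t * \<bar>t\<bar> powr \<delta>"

text \<open>Intended for $\delta < 2$ and $x > 0$; for $\delta \ge 1$ the integral is a principal value.\<close>

definition Ei_delta :: "real \<Rightarrow> real \<Rightarrow> real" where
  "Ei_delta \<delta> x =
     (if \<delta> < 1 then (LINT t:{..x}|lebesgue. exp t / signed_powr t \<delta>)
      else Lim (at_right 0) (\<lambda>\<epsilon>. (LINT t:{..-\<epsilon>}|lebesgue. exp t / signed_powr t \<delta>)
                               + (LINT t:{\<epsilon>..x}|lebesgue. exp t / signed_powr t \<delta>)))"

text \<open>The value at the origin, a null set, is irrelevant.\<close>

definition phi :: "real ^ 'n \<Rightarrow> real" where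
  "phi x = (let d = CARD('n); r = norm x in
     r powi (2 - int d) * exp (- (r\<^sup>2) / 2) * Ei_delta (2 - real d / 2) (r\<^sup>2 / 2))"

text \<open>Membership of (the class of) a function in $L^p$, for exponents $1 \le p \le \infty$.\<close>

definition in_Lp :: "'a measure \<Rightarrow> ennreal \<Rightarrow> ('a \<Rightarrow> real) \<Rightarrow> bool" where
  "in_Lp M p f \<longleftrightarrow> f \<in> borel_measurable M \<and>
     (if p = \<infinity> then \<exists>C. AE x in M. \<bar>f x\<bar> \<le> C
      else integrable M (\<lambda>x. \<bar>f x\<bar> powr enn2real p))"

definition partial_deriv :: "'n::finite \<Rightarrow> (real ^ 'n \<Rightarrow> complex) \<Rightarrow> real ^ 'n \<Rightarrow> complex" where
  "partial_deriv i f x = frechet_derivative f (at x) (axis i 1)"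

text \<open>Iterated partial derivatives are indexed by lists of coordinates instead of multi-indices;
  for smooth functions the order of the list does not matter.\<close>

definition iter_partial :: "'n::finite list \<Rightarrow> (real ^ 'n \<Rightarrow> complex) \<Rightarrow> real ^ 'n \<Rightarrow> complex" where
  "iter_partial ks f = foldr partial_deriv ks f"

definition smooth :: "(real ^ 'n::finite \<Rightarrow> complex) \<Rightarrow> bool" where
  "smooth f \<longleftrightarrow> (\<forall>ks x. iter_partial ks f differentiable (at x))"

definition schwartz :: "(real ^ 'n::finite \<Rightarrow> complex) set" where
  "schwartz = {f. smooth f \<and>
     (\<forall>N ks. bdd_above (range (\<lambda>x. (1 + (norm x)\<^sup>2) ^ N * norm (iter_partial ks f x))))}"

definition schwartz_seminorm :: "nat \<Rightarrow> 'n::finite list \<Rightarrow> (real ^ 'n \<Rightarrow> complex) \<Rightarrow> real" where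
  "schwartz_seminorm N ks f = (SUP x. (1 + (norm x)\<^sup>2) ^ N * norm (iter_partial ks f x))"

text \<open>The locally convex topology on the Schwartz space, generated by the seminorm balls.\<close>

definition schwartz_topology :: "(real ^ 'n::finite \<Rightarrow> complex) topology" where
  "schwartz_topology = topology_generated_by
     {{g \<in> schwartz. schwartz_seminorm N ks (\<lambda>x. g x - f x) < \<epsilon>} | N ks f \<epsilon>.
        f \<in> schwartz \<and> 0 < \<epsilon>}"

definition tempered_distribution :: "((real ^ 'n::finite \<Rightarrow> complex) \<Rightarrow> complex) \<Rightarrow> bool" where
  "tempered_distribution T \<longleftrightarrow>
     (\<forall>f\<in>schwartz. \<forall>g\<in>schwartz. T (\<lambda>x. f x + g x) = T f + T g) \<and>
     (\<forall>c. \<forall>f\<in>schwartz. T (\<lambda>x. c * f x) = c * T f) \<and>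
     continuous_map schwartz_topology euclidean T"

end

theory Submission
  imports Defs "HOL-Real_Asymp.Real_Asymp"
begin

text \<open>
Put \<open>d = CARD('n)\<close>, \<open>\<delta> = 2 - d / 2\<close> and \<open>s = (norm x)\<^sup>2 / 2\<close>. The function is radial, and only its
size at the origin and at infinity matters.

At infinity, \<open>Ei_delta \<delta> s\<close> is asymptotic to \<open>exp s * s powr (-\<delta>)\<close> (lemma
\<open>Ei_delta_asymptotics\<close>), and the powers combine so that \<open>phi x\<close> is asymptotic to
\<open>2 powr \<delta> * norm x powr (-2)\<close> in every dimension. At the origin, \<open>Ei_delta \<delta>\<close> tends to the
negative number \<open>- Gamma (1 - \<delta>)\<close> if \<open>\<delta> < 1\<close>, diverges logarithmically if \<open>\<delta> = 1\<close>, and like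
\<open>s powr (1 - \<delta>)\<close> if \<open>\<delta> > 1\<close>. So \<open>phi\<close> is bounded near the origin for \<open>d = 1\<close>, has a logarithmic
singularity for \<open>d = 2\<close>, and behaves like \<open>norm x powr (2 - d)\<close> for \<open>d \<ge> 3\<close>. The upper bounds are
lemmas \<open>phi_upper_near\<close> and \<open>phi_upper_far\<close>, the lower bounds \<open>phi_lower_near\<close> and
\<open>phi_lower_far\<close>.

The critical power for integrability, at the origin and at infinity, is \<open>norm x powr (-d)\<close>.
Comparison with it gives the first two claims. For \<open>d \<ge> 4\<close>, membership in the \<open>p\<close>-th Lebesgue space
would need \<open>2 * p > d\<close> at infinity and \<open>(d - 2) * p < d\<close> at the origin, hence both \<open>p > 2\<close> and
\<open>p < 2\<close>. On the other hand \<open>norm x powr (2 - d)\<close> is locally integrable and \<open>phi\<close> is bounded far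
from the origin, so \<open>phi\<close> is tempered (lemma \<open>tempered_distribution_of_weight\<close>).

The properties of \<open>Ei_delta\<close> rest on its derivative \<open>exp s * s powr (-\<delta>)\<close> (lemma
\<open>DERIV_Ei_delta\<close>), which needs the convergence of the principal value
(lemma \<open>principal_value_converges\<close>).
\<close>

section \<open>Integrability of radial powers\<close>

text \<open>Polar coordinates for radial functions, without any surface measure: two measures on the line
agree once they agree on all half-lines \<open>{..r}\<close>, and for the image of Lebesgue measure under the
norm these values are the volumes of balls.\<close>

lemma distr_norm_lborel:
  "distr lborel borel (norm :: 'a::euclidean_space \<Rightarrow> real) =
     density lborel (\<lambda>r. ennreal (real DIM('a) * unit_ball_vol DIM('a) * r ^ (DIM('a) - 1)) * indicator {0..} r)"
    (is "?M = ?N")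
proof (rule measure_eqI_generator_eq[where E = "range atMost" and \<Omega> = UNIV and A = "\<lambda>n. {..real n}"])
  let ?n = "DIM('a)"
  let ?V = "unit_ball_vol (real ?n)"
  have M: "emeasure ?M {..r} = ennreal (?V * r ^ ?n * indicator {0..} r)" for r
  proof -
    have "emeasure ?M {..r} = emeasure lborel (cball (0::'a) r)"
      by (simp add: emeasure_distr vimage_def cball_def)
    also have "\<dots> = ennreal (?V * r ^ ?n * indicator {0..} r)"
      by (cases "r \<ge> 0") (simp_all add: emeasure_cball)
    finally show ?thesis .
  qed
  have N: "emeasure ?N {..r} = ennreal (?V * r ^ ?n * indicator {0..} r)" for r
  proof -
    have "emeasure ?N {..r} = (\<integral>\<^sup>+t. ennreal (real ?n * ?V * t ^ (?n - 1)) * indicator {0..r} t \<partial>lborel)"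
      by (subst emeasure_density) (auto intro!: nn_integral_cong split: split_indicator)
    also have "\<dots> = ennreal (?V * r ^ ?n * indicator {0..} r)"
    proof (cases "r \<ge> 0")
      case True
      have "(\<integral>\<^sup>+t. ennreal (real ?n * ?V * t ^ (?n - 1)) * indicator {0..r} t \<partial>lborel) = ?V * r ^ ?n - ?V * 0 ^ ?n"
      proof (rule nn_integral_FTC_Icc)
        show "((\<lambda>t. ?V * t ^ ?n) has_real_derivative real ?n * ?V * t ^ (?n - 1)) (at t)" for t
          by (auto intro!: derivative_eq_intros)
      qed (use True in auto)
      then show ?thesis using True by simp
    qed simp
    finally show ?thesis .
  qed
  show "emeasure ?M X = emeasure ?N X" if "X \<in> range atMost" for X
    using that M N by auto
  show "emeasure ?M {..real n} \<noteq> \<infinity>" for n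
    by (simp add: M)
  show "sets ?M = sigma_sets UNIV (range atMost)" "sets ?N = sigma_sets UNIV (range atMost)"
    by (simp_all add: borel_eq_atMost)
  show "(\<Union>n. {..real n}) = UNIV"
    using real_arch_simple by auto
qed (auto simp: Int_stable_def)

lemma nn_integral_norm_powr:
  fixes I :: "real set" and a :: real
  assumes I: "I \<in> sets borel" "I \<subseteq> {0<..}"
  shows "(\<integral>\<^sup>+(x::'a::euclidean_space). ennreal (norm x powr (-a)) * indicator I (norm x) \<partial>lborel) =
    ennreal (real DIM('a) * unit_ball_vol DIM('a)) *
      (\<integral>\<^sup>+r. ennreal (r powr (real DIM('a) - 1 - a)) * indicator I r \<partial>lborel)"
proof -
  note [measurable] = I(1)
  have "(\<integral>\<^sup>+(x::'a). ennreal (norm x powr (-a)) * indicator I (norm x) \<partial>lborel) =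
      (\<integral>\<^sup>+r. ennreal (r powr (-a)) * indicator I r \<partial>distr lborel borel (norm :: 'a \<Rightarrow> real))"
    by (simp add: nn_integral_distr)
  also have "\<dots> = (\<integral>\<^sup>+r. ennreal (real DIM('a) * unit_ball_vol DIM('a) * r ^ (DIM('a) - 1)) * indicator {0..} r
      * (ennreal (r powr (-a)) * indicator I r) \<partial>lborel)"
    unfolding distr_norm_lborel by (subst nn_integral_density) auto
  also have "\<dots> = (\<integral>\<^sup>+r. ennreal (real DIM('a) * unit_ball_vol DIM('a)) *
      (ennreal (r powr (real DIM('a) - 1 - a)) * indicator I r) \<partial>lborel)"
  proof (intro nn_integral_cong)
    fix r :: real
    show "ennreal (real DIM('a) * unit_ball_vol DIM('a) * r ^ (DIM('a) - 1)) * indicator {0..} r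
      * (ennreal (r powr (-a)) * indicator I r) = ennreal (real DIM('a) * unit_ball_vol DIM('a)) *
      (ennreal (r powr (real DIM('a) - 1 - a)) * indicator I r)"
    proof (cases "r \<in> I")
      case True
      then have r: "r > 0" using I by auto
      have "real (DIM('a) - 1) = real DIM('a) - 1"
        using DIM_positive[where 'a='a] by linarith
      then have "r ^ (DIM('a) - 1) * r powr (-a) = r powr (real DIM('a) - 1 - a)"
        using r powr_add[of r "real DIM('a) - 1" "-a"] powr_realpow[of r "DIM('a) - 1"] by simp
      then show ?thesis
        using r True by (simp add: mult.assoc flip: ennreal_mult)
    qed simp
  qed
  also have "\<dots> = ennreal (real DIM('a) * unit_ball_vol DIM('a)) *
      (\<integral>\<^sup>+r. ennreal (r powr (real DIM('a) - 1 - a)) * indicator I r \<partial>lborel)"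
    by (rule nn_integral_cmult) simp
  finally show ?thesis .
qed

lemma nn_integral_norm_powr_finite:
  fixes a b :: real
  shows "a < DIM('a) \<Longrightarrow>
    (\<integral>\<^sup>+(x::'a::euclidean_space). ennreal (norm x powr (-a)) * indicator {0<..1} (norm x) \<partial>lborel) < \<infinity>"
    and "b > DIM('a) \<Longrightarrow>
    (\<integral>\<^sup>+(x::'a::euclidean_space). ennreal (norm x powr (-b)) * indicator {1..} (norm x) \<partial>lborel) < \<infinity>"
proof -
  assume "a < DIM('a)"
  then have "(\<integral>\<^sup>+r. ennreal (r powr (real DIM('a) - 1 - a)) * indicator {0..1} r \<partial>lborel) =
      ennreal (1 powr (real DIM('a) - 1 - a + 1) / (real DIM('a) - 1 - a + 1))"
    by (intro nn_integral_has_integral_lebesgue' has_integral_powr_from_0) auto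
  moreover have "(\<integral>\<^sup>+r. ennreal (r powr (real DIM('a) - 1 - a)) * indicator {0<..1} r \<partial>lborel) \<le>
      (\<integral>\<^sup>+r. ennreal (r powr (real DIM('a) - 1 - a)) * indicator {0..1} r \<partial>lborel)"
    by (intro nn_integral_mono) (auto split: split_indicator)
  ultimately have "(\<integral>\<^sup>+r. ennreal (r powr (real DIM('a) - 1 - a)) * indicator {0<..1} r \<partial>lborel) < \<infinity>"
    by (metis ennreal_less_top infinity_ennreal_def order_le_less_trans)
  then show "(\<integral>\<^sup>+(x::'a). ennreal (norm x powr (-a)) * indicator {0<..1} (norm x) \<partial>lborel) < \<infinity>"
    by (subst nn_integral_norm_powr) (auto simp: ennreal_mult_less_top)
next
  assume "b > DIM('a)"
  then have "(\<integral>\<^sup>+r. ennreal (r powr (real DIM('a) - 1 - b)) * indicator {1..} r \<partial>lborel) =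
      ennreal (- (1 powr (real DIM('a) - 1 - b + 1)) / (real DIM('a) - 1 - b + 1))"
    by (intro nn_integral_has_integral_lebesgue' has_integral_powr_to_inf) auto
  then show "(\<integral>\<^sup>+(x::'a). ennreal (norm x powr (-b)) * indicator {1..} (norm x) \<partial>lborel) < \<infinity>"
    by (subst nn_integral_norm_powr) (auto simp: ennreal_mult_less_top)
qed

text \<open>All the integrability claims reduce to this criterion: a power singularity at the origin weaker
than the critical one, and power decay at infinity faster than the critical one.\<close>

lemma integrable_norm_powr_dominated:
  fixes f :: "'a::euclidean_space \<Rightarrow> 'b::{banach, second_countable_topology}"
    and a b A B :: real
  assumes f: "f \<in> borel_measurable borel" and ab: "a < DIM('a)" "DIM('a) < b"
    and near: "\<And>x. x \<noteq> 0 \<Longrightarrow> norm x \<le> 1 \<Longrightarrow> norm (f x) \<le> A * norm x powr (-a)"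
    and far: "\<And>x. norm x \<ge> 1 \<Longrightarrow> norm (f x) \<le> B * norm x powr (-b)"
  shows "integrable lebesgue f"
proof -
  define C where "C = max \<bar>A\<bar> \<bar>B\<bar>"
  let ?g = "\<lambda>x::'a. ennreal (norm x powr (-a)) * indicator {0<..1} (norm x)"
  let ?h = "\<lambda>x::'a. ennreal (norm x powr (-b)) * indicator {1..} (norm x)"
  have "ennreal (norm (f x)) \<le> ennreal C * (?g x + ?h x)" if "x \<noteq> 0" for x
  proof (cases "norm x \<le> 1")
    case True
    have "norm (f x) \<le> C * norm x powr (-a)"
      by (rule order_trans[OF near[OF that True]], rule mult_right_mono) (auto simp: C_def)
    then have "ennreal (norm (f x)) \<le> ennreal C * ?g x"
      using True that by (simp add: C_def flip: ennreal_mult)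
    also have "\<dots> \<le> ennreal C * (?g x + ?h x)"
      by (intro mult_left_mono) auto
    finally show ?thesis .
  next
    case False
    then have x: "norm x \<ge> 1" by simp
    have "norm (f x) \<le> C * norm x powr (-b)"
      by (rule order_trans[OF far[OF x]], rule mult_right_mono) (auto simp: C_def)
    then have "ennreal (norm (f x)) \<le> ennreal C * ?h x"
      using x by (simp add: C_def flip: ennreal_mult)
    also have "\<dots> \<le> ennreal C * (?g x + ?h x)"
      by (intro mult_left_mono) auto
    finally show ?thesis .
  qed
  then have "(\<integral>\<^sup>+x. ennreal (norm (f x)) \<partial>lborel) \<le> (\<integral>\<^sup>+x. ennreal C * (?g x + ?h x) \<partial>lborel)"
    by (intro nn_integral_mono_AE eventually_mono[OF AE_lborel_singleton[of 0]])
  also have "\<dots> = ennreal C * ((\<integral>\<^sup>+x. ?g x \<partial>lborel) + (\<integral>\<^sup>+x. ?h x \<partial>lborel))"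
    by (simp add: nn_integral_cmult nn_integral_add)
  also have "\<dots> < \<infinity>"
    using nn_integral_norm_powr_finite(1)[OF ab(1)] nn_integral_norm_powr_finite(2)[OF ab(2)]
    by (simp add: ennreal_mult_less_top)
  finally have "integrable lborel f"
    using f by (intro integrableI_bounded) auto
  then show ?thesis
    using f by (subst integrable_completion) auto
qed

text \<open>The exponent \<open>- DIM('a)\<close> is critical at the origin and at infinity alike: in the radial variable
it gives \<open>1 / r\<close>, whose integral over \<open>{u..u * exp K}\<close> is \<open>K\<close> for every \<open>u\<close>. The hypothesis
\<open>long\<close> covers both ends: it holds for \<open>{0<..b}\<close> and for \<open>{R..}\<close>.\<close>

lemma not_integrable_norm_powr_DIM:
  fixes f :: "'a::euclidean_space \<Rightarrow> 'b::{banach, second_countable_topology}"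
  assumes I: "I \<in> sets borel" "I \<subseteq> {0<..}"
    and long: "\<And>K. K > 0 \<Longrightarrow> \<exists>u>0. {u..u * exp K} \<subseteq> I"
    and c: "c > 0" and bound: "\<And>x. norm x \<in> I \<Longrightarrow> c * norm x powr (- real DIM('a)) \<le> norm (f x)"
  shows "\<not> integrable lebesgue f"
proof
  assume f: "integrable lebesgue f"
  note [measurable] = I(1)
  let ?J = "\<integral>\<^sup>+r. ennreal (r powr (real DIM('a) - 1 - real DIM('a))) * indicator I r \<partial>lborel"
  have "ennreal K \<le> ?J" if "K > 0" for K
  proof -
    obtain u where u: "u > 0" "{u..u * exp K} \<subseteq> I"
        using long[OF \<open>K > 0\<close>] by blast
    have "u * 1 \<le> u * exp K"
      using u that by (intro mult_left_mono) auto
    then have le: "u \<le> u * exp K" by simp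
    have "(\<integral>\<^sup>+r. ennreal (r powr (-1)) * indicator {u..u * exp K} r \<partial>lborel) = ln (u * exp K) - ln u"
      using u le by (intro nn_integral_FTC_Icc)
        (auto intro!: derivative_eq_intros simp: powr_minus divide_inverse)
    moreover have "(\<integral>\<^sup>+r. ennreal (r powr (-1)) * indicator {u..u * exp K} r \<partial>lborel) \<le> ?J"
      using u by (intro nn_integral_mono) (auto split: split_indicator)
    moreover have "ln (u * exp K) - ln u = K"
      using u by (simp add: ln_mult)
    ultimately show ?thesis by simp
  qed
  then have J: "?J = \<infinity>"
  proof (cases ?J)
    case (real j)
    with \<open>\<And>K. K > 0 \<Longrightarrow> ennreal K \<le> ?J\<close>[of "j + 1"] show ?thesis
      by simp
  qed simp
  have "ennreal c * (\<integral>\<^sup>+(x::'a). ennreal (norm x powr (- real DIM('a))) * indicator I (norm x) \<partial>lborel) =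
      (\<integral>\<^sup>+(x::'a). ennreal c * (ennreal (norm x powr (- real DIM('a))) * indicator I (norm x)) \<partial>lborel)"
    by (subst nn_integral_cmult) auto
  also have "\<dots> = (\<integral>\<^sup>+(x::'a). ennreal c * (ennreal (norm x powr (- real DIM('a))) * indicator I (norm x)) \<partial>lebesgue)"
    by (subst nn_integral_completion) auto
  also have "\<dots> \<le> (\<integral>\<^sup>+x. ennreal (norm (f x)) \<partial>lebesgue)"
    using bound c by (intro nn_integral_mono) (auto split: split_indicator simp flip: ennreal_mult)
  also have "\<dots> < \<infinity>"
    using f by (simp add: integrable_iff_bounded)
  finally have "(\<integral>\<^sup>+(x::'a). ennreal (norm x powr (- real DIM('a))) * indicator I (norm x) \<partial>lborel) < \<infinity>"
    using c by (auto simp: ennreal_mult_less_top)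
  moreover have "ennreal (real DIM('a) * unit_ball_vol DIM('a)) \<noteq> 0"
    using unit_ball_vol_pos[of "real DIM('a)"] by (simp add: less_le)
  ultimately show False
    using J unfolding nn_integral_norm_powr[OF I] by (simp add: ennreal_mult_top)
qed

section \<open>The exponential integral function\<close>

definition ei_integrand :: "real \<Rightarrow> real \<Rightarrow> real" where
  "ei_integrand \<delta> t = exp t / signed_powr t \<delta>"

lemma ei_integrand_pos: "t > 0 \<Longrightarrow> ei_integrand \<delta> t = exp t * t powr (-\<delta>)"
  by (simp add: ei_integrand_def signed_powr_def powr_minus field_simps)

lemma ei_integrand_neg: "t > 0 \<Longrightarrow> ei_integrand \<delta> (-t) = - (exp (-t) * t powr (-\<delta>))"
  by (simp add: ei_integrand_def signed_powr_def powr_minus field_simps)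

text \<open>Every improper integral below converges because its integrand is dominated, after a reflection
if necessary, by an integrand of Euler's Gamma integral; the case \<open>s = 1 - \<delta>\<close> serves the
integrable singularity, and larger \<open>s\<close> the tail and the symmetrized integrand.\<close>

lemma absolutely_integrable_Gamma_dominated:
  fixes f :: "real \<Rightarrow> real"
  assumes s: "s > 0" and S: "S \<in> sets lebesgue" "S \<subseteq> {0<..}" and cont: "continuous_on S f"
    and bound: "\<And>t. t \<in> S \<Longrightarrow> \<bar>f t\<bar> \<le> C * (t powr (s - 1) / exp t)"
  shows "f absolutely_integrable_on S"
proof (rule measurable_bounded_by_integrable_imp_absolutely_integrable)
  show "f \<in> borel_measurable (lebesgue_on S)"
    using cont S(1) by (rule continuous_imp_measurable_on_sets_lebesgue)
  have "(\<lambda>t. t powr (s - 1) / exp t) absolutely_integrable_on {0..}"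
    using Gamma_integral_real[OF s] by (intro nonnegative_absolutely_integrable_1) auto
  then have "(\<lambda>t. t powr (s - 1) / exp t) absolutely_integrable_on S"
    by (rule set_integrable_subset) (use S in force)+
  then show "(\<lambda>t. C * (t powr (s - 1) / exp t)) integrable_on S"
    by (intro integrable_on_mult_right set_lebesgue_integral_eq_integral(1))
qed (use S bound in auto)

lemma continuous_on_ei_integrand:
  assumes "S \<subseteq> {0<..}"
  shows "continuous_on S (ei_integrand \<delta>)" "continuous_on S (\<lambda>t. ei_integrand \<delta> (-t))"
proof -
  have "continuous_on S (\<lambda>t. exp t * t powr (-\<delta>))"
    "continuous_on S (\<lambda>t. - (exp (-t) * t powr (-\<delta>)))"
    using assms by (auto intro!: continuous_on_minus continuous_on_mult continuous_on_exp
        continuous_on_powr continuous_on_const continuous_on_id)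
  then show "continuous_on S (ei_integrand \<delta>)" "continuous_on S (\<lambda>t. ei_integrand \<delta> (-t))"
    using assms by (auto simp: ei_integrand_pos ei_integrand_neg subset_iff cong: continuous_on_cong)
qed

lemma ei_integrand_interval:
  "0 < a \<Longrightarrow> ei_integrand \<delta> absolutely_integrable_on {a..b}"
  "0 < a \<Longrightarrow> (\<lambda>t. ei_integrand \<delta> (-t)) absolutely_integrable_on {a..b}"
  by (intro absolutely_integrable_continuous_real continuous_on_ei_integrand; force)+

lemma ei_integrand_reflected_tail:
  assumes "\<epsilon> > 0" "\<delta> < 2"
  shows "(\<lambda>t. ei_integrand \<delta> (-t)) absolutely_integrable_on {\<epsilon>..}"
proof (rule absolutely_integrable_Gamma_dominated[where s = "3 - \<delta>" and C = "\<epsilon> powr -2"])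
  fix t assume t: "t \<in> {\<epsilon>..}"
  have "t powr (-\<delta>) = t powr (-2) * t powr (2 - \<delta>)"
    using t assms by (simp flip: powr_add)
  also have "\<dots> \<le> \<epsilon> powr -2 * t powr (2 - \<delta>)"
    using t assms by (intro mult_right_mono powr_mono2') auto
  finally have "exp (-t) * t powr (-\<delta>) \<le> exp (-t) * (\<epsilon> powr -2 * t powr (2 - \<delta>))"
    by (rule mult_left_mono) auto
  then show "\<bar>ei_integrand \<delta> (-t)\<bar> \<le> \<epsilon> powr -2 * (t powr (3 - \<delta> - 1) / exp t)"
    using t assms by (simp add: ei_integrand_neg abs_mult exp_minus field_simps)
qed (use assms in \<open>auto intro!: continuous_on_ei_integrand\<close>)

lemma ei_integrand_reflected_whole:
  assumes "\<delta> < 1"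
  shows "(\<lambda>t. ei_integrand \<delta> (-t)) absolutely_integrable_on {0<..}"
  by (rule absolutely_integrable_Gamma_dominated[where s = "1 - \<delta>" and C = 1])
    (use assms in \<open>auto intro!: continuous_on_ei_integrand
       simp: ei_integrand_neg abs_mult exp_minus field_simps\<close>)

lemma ei_integrand_near_0:
  assumes "\<delta> < 1"
  shows "ei_integrand \<delta> absolutely_integrable_on {0<..x}"
proof (rule absolutely_integrable_Gamma_dominated[where s = "1 - \<delta>" and C = "exp (2 * x)"])
  fix t assume t: "t \<in> {0<..x}"
  then have "exp t * exp t \<le> exp (2 * x)"
    by (simp flip: exp_add)
  then have "(exp t * exp t) * t powr (-\<delta>) \<le> exp (2 * x) * t powr (-\<delta>)"
    by (rule mult_right_mono) auto
  then show "\<bar>ei_integrand \<delta> t\<bar> \<le> exp (2 * x) * (t powr (1 - \<delta> - 1) / exp t)"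
    using t by (simp add: ei_integrand_pos abs_mult field_simps)
qed (use assms in \<open>auto intro!: continuous_on_ei_integrand\<close>)

text \<open>The cancellation behind the principal value: with the sign convention for \<open>t < 0\<close>, the singular
parts at \<open>t\<close> and \<open>-t\<close> combine to \<open>(exp t - exp (-t)) * t powr (-\<delta>)\<close>, and the first factor is
\<open>O(t)\<close>, which makes the product integrable at the origin exactly when \<open>\<delta> < 2\<close>.\<close>

lemma ei_integrand_symmetrized:
  assumes "\<delta> < 2"
  shows "(\<lambda>t. ei_integrand \<delta> t + ei_integrand \<delta> (-t)) absolutely_integrable_on {0<..x}"
proof (rule absolutely_integrable_Gamma_dominated[where s = "2 - \<delta>" and C = "2 * exp (2 * x)"])
  fix t assume t: "t \<in> {0<..x}"
  have "exp t * (exp t - exp (-t)) = exp (2 * t) - 1"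
    by (simp add: algebra_simps flip: exp_add)
  also have "\<dots> \<le> 2 * t * exp (2 * t)"
    using exp_ge_add_one_self[of "-(2 * t)"] by (simp add: exp_minus field_simps)
  also have "\<dots> \<le> 2 * t * exp (2 * x)"
    using t by (intro mult_left_mono) auto
  finally have "exp t * (exp t - exp (-t)) * t powr (-\<delta>) \<le> 2 * t * exp (2 * x) * t powr (-\<delta>)"
    by (rule mult_right_mono) auto
  also have "\<dots> = 2 * exp (2 * x) * t powr (2 - \<delta> - 1)"
    using t powr_add[of t 1 "-\<delta>"] by simp
  finally have "(exp t - exp (-t)) * t powr (-\<delta>) \<le> 2 * exp (2 * x) * (t powr (2 - \<delta> - 1) / exp t)"
    by (simp add: field_simps)
  moreover have "ei_integrand \<delta> t + ei_integrand \<delta> (-t) = (exp t - exp (-t)) * t powr (-\<delta>)"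
    using t by (simp only: ei_integrand_pos ei_integrand_neg greaterThanAtMost_iff) (simp add: algebra_simps)
  moreover have "(exp t - exp (-t)) * t powr (-\<delta>) \<ge> 0"
    using t by (intro mult_nonneg_nonneg) auto
  ultimately show "\<bar>ei_integrand \<delta> t + ei_integrand \<delta> (-t)\<bar> \<le> 2 * exp (2 * x) * (t powr (2 - \<delta> - 1) / exp t)"
    by linarith
qed (use assms in \<open>auto intro!: continuous_on_ei_integrand continuous_on_add\<close>)

lemma ei_integrand_left:
  assumes "\<epsilon> > 0" "\<delta> < 2"
  shows "ei_integrand \<delta> absolutely_integrable_on {..-\<epsilon>}"
    "integral {..-\<epsilon>} (ei_integrand \<delta>) = integral {\<epsilon>..} (\<lambda>t. ei_integrand \<delta> (-t))"
  using has_absolute_integral_reflect_real[of "{\<epsilon>..}" "{..-\<epsilon>}" "ei_integrand \<delta>"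
      "integral {\<epsilon>..} (\<lambda>t. ei_integrand \<delta> (-t))"] ei_integrand_reflected_tail[OF assms]
  by (auto simp: image_subset_iff)

lemma ei_integrand_left_0:
  assumes "\<delta> < 1"
  shows "ei_integrand \<delta> absolutely_integrable_on {..<0}"
    "integral {..<0} (ei_integrand \<delta>) = integral {0<..} (\<lambda>t. ei_integrand \<delta> (-t))"
  using has_absolute_integral_reflect_real[of "{0<..}" "{..<0}" "ei_integrand \<delta>"
      "integral {0<..} (\<lambda>t. ei_integrand \<delta> (-t))"] ei_integrand_reflected_whole[OF assms]
  by (auto simp: image_subset_iff)

text \<open>Reflecting the part of \<open>{..-\<epsilon>}\<close> that faces \<open>{\<epsilon>..x}\<close> leaves the symmetrized integrand on
\<open>{\<epsilon>..x}\<close> plus a term independent of \<open>\<epsilon>\<close>. Convergence has to be established first: \<open>Lim\<close> is a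
description operator and says nothing about a divergent expression.\<close>

lemma principal_value_converges:
  assumes "\<delta> < 2" "x > 0"
  shows "\<exists>L. ((\<lambda>\<epsilon>. integral {..-\<epsilon>} (ei_integrand \<delta>) + integral {\<epsilon>..x} (ei_integrand \<delta>))
           \<longlongrightarrow> L) (at_right 0)"
proof -
  let ?g = "ei_integrand \<delta>" and ?h = "\<lambda>t. ei_integrand \<delta> (-t)"
  have "((\<lambda>\<epsilon>. LINT t:{\<epsilon>..x}|lebesgue. ?g t + ?h t) \<longlongrightarrow>
      (LINT t:{0<..x}|lebesgue. ?g t + ?h t)) (at_right 0)"
    using assms by (intro tendsto_set_lebesgue_integral_at_right ei_integrand_symmetrized) auto
  then have lim: "((\<lambda>\<epsilon>. integral {x..} ?h + (LINT t:{\<epsilon>..x}|lebesgue. ?g t + ?h t)) \<longlongrightarrow>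
      integral {x..} ?h + (LINT t:{0<..x}|lebesgue. ?g t + ?h t)) (at_right 0)"
    by (intro tendsto_intros)
  have "integral {x..} ?h + (LINT t:{\<epsilon>..x}|lebesgue. ?g t + ?h t)
      = integral {..-\<epsilon>} ?g + integral {\<epsilon>..x} ?g" if \<epsilon>: "\<epsilon> \<in> {0<..<x}" for \<epsilon>
  proof -
    have g: "?g absolutely_integrable_on {\<epsilon>..x}" and h: "?h absolutely_integrable_on {\<epsilon>..x}"
      using ei_integrand_interval \<epsilon> by auto
    have "(LINT t:{\<epsilon>..x}|lebesgue. ?g t + ?h t) = integral {\<epsilon>..x} ?g + integral {\<epsilon>..x} ?h"
      using set_integral_add(2)[OF g h] set_lebesgue_integral_eq_integral(2)[OF g]
        set_lebesgue_integral_eq_integral(2)[OF h] by simp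
    moreover have "integral ({\<epsilon>..x} \<union> {x..}) ?h = integral {\<epsilon>..x} ?h + integral {x..} ?h"
      using assms h by (intro integral_Un set_lebesgue_integral_eq_integral(1) ei_integrand_reflected_tail)
        (auto intro: negligible_subset[of "{x}"])
    moreover have "{\<epsilon>..x} \<union> {x..} = {\<epsilon>..}"
      using \<epsilon> by auto
    ultimately show ?thesis
      using ei_integrand_left(2)[of \<epsilon> \<delta>] \<epsilon> assms by simp
  qed
  then have "\<forall>\<^sub>F \<epsilon> in at_right 0. integral {x..} ?h + (LINT t:{\<epsilon>..x}|lebesgue. ?g t + ?h t)
      = integral {..-\<epsilon>} ?g + integral {\<epsilon>..x} ?g"
    using eventually_at_right_real[OF assms(2)] by (rule eventually_mono[rotated]) 
  then show ?thesis
    using lim by (auto intro: Lim_transform_eventually)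
qed

lemma Ei_delta_less_1:
  assumes "\<delta> < 1" "x > 0"
  shows "ei_integrand \<delta> absolutely_integrable_on {..x}"
    "Ei_delta \<delta> x = integral {..x} (ei_integrand \<delta>)"
proof -
  have "ei_integrand \<delta> absolutely_integrable_on ({..<0} \<union> ({0} \<union> {0<..x}))"
    using assms by (intro set_integrable_Un ei_integrand_left_0 ei_integrand_near_0
        absolutely_integrable_negligible) auto
  moreover have "{..<0} \<union> ({0} \<union> {0<..x}) = {..x}"
    using assms by auto
  ultimately show *: "ei_integrand \<delta> absolutely_integrable_on {..x}"
    by simp
  show "Ei_delta \<delta> x = integral {..x} (ei_integrand \<delta>)"
    using assms set_lebesgue_integral_eq_integral(2)[OF *] by (simp add: Ei_delta_def ei_integrand_def)
qed

lemma Ei_delta_PV: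
  assumes "1 \<le> \<delta>" "\<delta> < 2" "x > 0"
  shows "((\<lambda>\<epsilon>. integral {..-\<epsilon>} (ei_integrand \<delta>) + integral {\<epsilon>..x} (ei_integrand \<delta>))
           \<longlongrightarrow> Ei_delta \<delta> x) (at_right 0)"
proof -
  obtain L where L: "((\<lambda>\<epsilon>. integral {..-\<epsilon>} (ei_integrand \<delta>) + integral {\<epsilon>..x} (ei_integrand \<delta>))
      \<longlongrightarrow> L) (at_right 0)"
    using principal_value_converges assms by blast
  have "\<forall>\<^sub>F \<epsilon> in at_right 0. integral {..-\<epsilon>} (ei_integrand \<delta>) + integral {\<epsilon>..x} (ei_integrand \<delta>)
     = (LINT t:{..-\<epsilon>}|lebesgue. ei_integrand \<delta> t) + (LINT t:{\<epsilon>..x}|lebesgue. ei_integrand \<delta> t)"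
    using eventually_at_right_less[of 0]
  proof eventually_elim
    case (elim \<epsilon>)
    then show ?case
      using set_lebesgue_integral_eq_integral(2)[OF ei_integrand_left(1)[of \<epsilon> \<delta>]]
        set_lebesgue_integral_eq_integral(2)[OF ei_integrand_interval(1)[of \<epsilon> x \<delta>]] assms by simp
  qed
  from Lim_transform_eventually[OF L this] have "Ei_delta \<delta> x = L"
    using assms by (simp add: Ei_delta_def ei_integrand_def[abs_def] tendsto_Lim)
  with L show ?thesis by simp
qed

lemma Ei_delta_diff:
  assumes "\<delta> < 2" "0 < x" "x \<le> y"
  shows "Ei_delta \<delta> y = Ei_delta \<delta> x + integral {x..y} (ei_integrand \<delta>)"
proof (cases "\<delta> < 1")
  case True
  have "integral ({..x} \<union> {x..y}) (ei_integrand \<delta>) = integral {..x} (ei_integrand \<delta>) + integral {x..y} (ei_integrand \<delta>)"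
    using assms True by (intro integral_Un set_lebesgue_integral_eq_integral(1) Ei_delta_less_1 ei_integrand_interval)
      (auto intro: negligible_subset[of "{x}"])
  moreover have "{..x} \<union> {x..y} = {..y}"
    using assms by auto
  ultimately show ?thesis
    using Ei_delta_less_1(2) True assms by simp
next
  case False
  let ?g = "ei_integrand \<delta>"
  have "\<forall>\<^sub>F \<epsilon> in at_right 0. (integral {..-\<epsilon>} ?g + integral {\<epsilon>..x} ?g) + integral {x..y} ?g
      = integral {..-\<epsilon>} ?g + integral {\<epsilon>..y} ?g"
    using eventually_at_right_real[OF assms(2)]
  proof eventually_elim
    case (elim \<epsilon>)
    then show ?case
      using Henstock_Kurzweil_Integration.integral_combine[of \<epsilon> x y ?g] assms
        set_lebesgue_integral_eq_integral(1)[OF ei_integrand_interval(1)[of \<epsilon> y \<delta>]] by simp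
  qed
  moreover have "((\<lambda>\<epsilon>. (integral {..-\<epsilon>} ?g + integral {\<epsilon>..x} ?g) + integral {x..y} ?g)
      \<longlongrightarrow> Ei_delta \<delta> x + integral {x..y} ?g) (at_right 0)"
    using False assms by (intro tendsto_intros Ei_delta_PV) auto
  ultimately have "((\<lambda>\<epsilon>. integral {..-\<epsilon>} ?g + integral {\<epsilon>..y} ?g)
      \<longlongrightarrow> Ei_delta \<delta> x + integral {x..y} ?g) (at_right 0)"
    by (rule Lim_transform_eventually[rotated])
  moreover have "((\<lambda>\<epsilon>. integral {..-\<epsilon>} ?g + integral {\<epsilon>..y} ?g) \<longlongrightarrow> Ei_delta \<delta> y) (at_right 0)"
    using False assms by (intro Ei_delta_PV) auto
  ultimately show ?thesis
    using tendsto_unique trivial_limit_at_right_real by blast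
qed

text \<open>Both cases of the definition have the same derivative, and nearly everything else about the
function follows from it alone.\<close>

lemma DERIV_Ei_delta:
  assumes "\<delta> < 2" "x > 0"
  shows "(Ei_delta \<delta> has_real_derivative exp x * x powr (-\<delta>)) (at x)"
proof -
  let ?a = "x / 2" and ?b = "2 * x"
  have "((\<lambda>y. integral {?a..y} (ei_integrand \<delta>)) has_real_derivative ei_integrand \<delta> x)
      (at x within {?a..?b})"
    using assms by (intro integral_has_real_derivative continuous_on_ei_integrand) auto
  moreover have "at x within {?a..?b} = at x"
    using assms by (intro at_within_Icc_at) auto
  ultimately have "((\<lambda>y. Ei_delta \<delta> ?a + integral {?a..y} (ei_integrand \<delta>)) has_real_derivative
      0 + ei_integrand \<delta> x) (at x)"
    by (intro DERIV_add DERIV_const) auto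
  then have "((\<lambda>y. Ei_delta \<delta> ?a + integral {?a..y} (ei_integrand \<delta>)) has_real_derivative
      exp x * x powr (-\<delta>)) (at x)"
    using assms by (simp add: ei_integrand_pos)
  then show ?thesis
  proof (rule has_field_derivative_transform_within_open)
    show "Ei_delta \<delta> ?a + integral {?a..y} (ei_integrand \<delta>) = Ei_delta \<delta> y" if "y \<in> {?a<..}" for y
      using Ei_delta_diff[of \<delta> ?a y] that assms by auto
  qed (use assms in auto)
qed

lemma continuous_on_Ei_delta: "\<delta> < 2 \<Longrightarrow> continuous_on {0<..} (Ei_delta \<delta>)"
  by (intro continuous_at_imp_continuous_on) (auto intro: DERIV_isCont DERIV_Ei_delta)

text \<open>L'Hopital: the quotient of the derivatives of \<open>Ei_delta \<delta>\<close> and of \<open>exp x * x powr (-\<delta>)\<close> is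
\<open>1 / (1 - \<delta> / x)\<close>.\<close>

lemma Ei_delta_asymptotics:
  assumes "\<delta> < 2"
  shows "((\<lambda>x. exp (-x) * x powr \<delta> * Ei_delta \<delta> x) \<longlongrightarrow> 1) at_top"
proof -
  have "((\<lambda>x. Ei_delta \<delta> x / (exp x * x powr (-\<delta>))) \<longlongrightarrow> 1) at_top"
  proof (rule lhospital_at_top_at_top)
    show "filterlim (\<lambda>x. exp x * x powr (-\<delta>)) at_top at_top"
      by real_asymp
    have ev: "\<forall>\<^sub>F x in at_top. x > max 0 \<delta>"
      by (rule eventually_gt_at_top)
    then show "\<forall>\<^sub>F x in at_top. (Ei_delta \<delta> has_real_derivative exp x * x powr (-\<delta>)) (at x)"
      by eventually_elim (use assms DERIV_Ei_delta in auto)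
    show "\<forall>\<^sub>F x in at_top. ((\<lambda>x. exp x * x powr (-\<delta>)) has_real_derivative
        exp x * x powr (-\<delta>) * (1 - \<delta> / x)) (at x)"
      using ev
    proof eventually_elim
      case (elim x)
      have "((\<lambda>x. exp x * x powr (-\<delta>)) has_real_derivative
          exp x * x powr (-\<delta>) + (-\<delta> * x powr (-\<delta> - 1)) * exp x) (at x)"
        using elim by (intro DERIV_mult DERIV_exp has_real_derivative_powr) auto
      moreover have "x powr (-\<delta> - 1) = x powr (-\<delta>) / x"
        using elim by (simp add: powr_diff)
      ultimately show ?case
        by (simp add: algebra_simps)
    qed
    show "\<forall>\<^sub>F x in at_top. exp x * x powr (-\<delta>) * (1 - \<delta> / x) \<noteq> 0"
      using ev by eventually_elim (auto simp: field_simps)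
    have "((\<lambda>x. 1 / (1 - \<delta> / x)) \<longlongrightarrow> 1) at_top"
      by real_asymp
    moreover have "\<forall>\<^sub>F x in at_top. 1 / (1 - \<delta> / x) =
        exp x * x powr (-\<delta>) / (exp x * x powr (-\<delta>) * (1 - \<delta> / x))"
      using ev by eventually_elim (auto simp: field_simps)
    ultimately show "((\<lambda>x. exp x * x powr (-\<delta>) / (exp x * x powr (-\<delta>) * (1 - \<delta> / x))) \<longlongrightarrow> 1) at_top"
      by (rule Lim_transform_eventually)
  qed
  moreover have "\<forall>\<^sub>F x in at_top. Ei_delta \<delta> x / (exp x * x powr (-\<delta>)) = exp (-x) * x powr \<delta> * Ei_delta \<delta> x"
    using eventually_gt_at_top[of 0] by eventually_elim (simp add: exp_minus powr_minus field_simps)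
  ultimately show ?thesis
    by (rule Lim_transform_eventually)
qed

lemma Ei_delta_bound_away_from_0:
  assumes "\<delta> < 2" "a > 0"
  shows "\<exists>C. \<forall>x\<ge>a. \<bar>exp (-x) * x powr \<delta> * Ei_delta \<delta> x\<bar> \<le> C"
proof -
  let ?M = "\<lambda>x. exp (-x) * x powr \<delta> * Ei_delta \<delta> x"
  have "\<forall>\<^sub>F x in at_top. \<bar>?M x\<bar> < 2"
    using order_tendstoD(2)[OF tendsto_rabs[OF Ei_delta_asymptotics[OF assms(1)]], of 2] by simp
  then obtain b where b: "\<And>x. x \<ge> b \<Longrightarrow> \<bar>?M x\<bar> < 2"
    by (auto simp: eventually_at_top_linorder)
  have "continuous_on {a..b} ?M"
    using assms by (intro continuous_intros continuous_on_subset[OF continuous_on_Ei_delta]) auto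
  then have "bounded (?M ` {a..b})"
    by (intro compact_imp_bounded compact_continuous_image) auto
  then obtain C where C: "\<And>x. x \<in> {a..b} \<Longrightarrow> \<bar>?M x\<bar> \<le> C"
    by (fastforce simp: bounded_iff)
  have "\<bar>?M x\<bar> \<le> max C 2" if "x \<ge> a" for x
    using b[of x] C[of x] that by (cases "x \<le> b") auto
  then show ?thesis by blast
qed

text \<open>Integrating the derivative from \<open>x\<close> to \<open>1\<close>, with \<open>t powr (-\<delta>)\<close> replaced by the larger
\<open>t powr (-\<sigma> - 1)\<close>. Insisting on \<open>\<sigma> > 0\<close> loses at most an arbitrarily small power, but it treats the
logarithmic singularity (\<open>\<delta> = 1\<close>), the power singularity (\<open>\<delta> > 1\<close>) and the bounded case
(\<open>\<delta> < 1\<close>) in one stroke.\<close>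

lemma Ei_delta_bound_near_0:
  assumes "\<delta> < 2" "\<sigma> > 0" "\<delta> \<le> \<sigma> + 1"
  shows "\<exists>C. \<forall>x. 0 < x \<longrightarrow> x \<le> 1 \<longrightarrow> \<bar>Ei_delta \<delta> x\<bar> \<le> C * x powr (-\<sigma>)"
proof -
  have "\<bar>Ei_delta \<delta> x\<bar> \<le> (\<bar>Ei_delta \<delta> 1\<bar> + exp 1 / \<sigma>) * x powr (-\<sigma>)" if x: "0 < x" "x \<le> 1" for x
  proof -
    let ?D = "\<lambda>x. Ei_delta \<delta> x + exp 1 / \<sigma> * x powr (-\<sigma>)"
    have "Ei_delta \<delta> x \<le> Ei_delta \<delta> 1"
    proof (rule DERIV_nonneg_imp_nondecreasing[OF x(2)])
      fix t assume "x \<le> t" "t \<le> 1"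
      then show "\<exists>y. (Ei_delta \<delta> has_real_derivative y) (at t) \<and> 0 \<le> y"
        using x by (intro exI[of _ "exp t * t powr (-\<delta>)"] conjI DERIV_Ei_delta assms) auto
    qed
    moreover have "?D 1 \<le> ?D x"
    proof (rule DERIV_nonpos_imp_nonincreasing[OF x(2)])
      fix t assume t: "x \<le> t" "t \<le> 1"
      have "(?D has_real_derivative exp t * t powr (-\<delta>) - exp 1 * t powr (-\<sigma> - 1)) (at t)"
      proof -
        have "(?D has_real_derivative
            exp t * t powr (-\<delta>) + exp 1 / \<sigma> * (-\<sigma> * t powr (-\<sigma> - 1))) (at t)"
          using t x assms
          by (intro DERIV_add DERIV_cmult DERIV_Ei_delta has_real_derivative_powr) auto
        then show ?thesis
          using assms by simp
      qed
      moreover have "exp t * t powr (-\<delta>) \<le> exp 1 * t powr (-\<sigma> - 1)"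
        using t x assms by (intro mult_mono powr_mono') auto
      ultimately show "\<exists>y. (?D has_real_derivative y) (at t) \<and> y \<le> 0"
        by (intro exI conjI) auto
    qed
    ultimately have "\<bar>Ei_delta \<delta> x\<bar> \<le> \<bar>Ei_delta \<delta> 1\<bar> * 1 + exp 1 / \<sigma> * x powr (-\<sigma>)"
    proof -
      have "0 \<le> exp 1 / \<sigma>" "0 \<le> exp 1 / \<sigma> * x powr (-\<sigma>)"
        using assms by auto
      with \<open>Ei_delta \<delta> x \<le> Ei_delta \<delta> 1\<close> \<open>?D 1 \<le> ?D x\<close> show ?thesis
        by simp
    qed
    also have "\<dots> \<le> \<bar>Ei_delta \<delta> 1\<bar> * x powr (-\<sigma>) + exp 1 / \<sigma> * x powr (-\<sigma>)"
      using x assms powr_mono'[of "-\<sigma>" 0 x] by (intro add_right_mono mult_left_mono) auto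
    finally show ?thesis by (simp add: algebra_simps)
  qed
  then show ?thesis by blast
qed

text \<open>At the origin the value is the integral over the negative half-line, which is
\<open>- Gamma (1 - \<delta>)\<close>; the integral over \<open>{0..x}\<close> cannot compensate it for small \<open>x\<close>.\<close>

lemma Ei_delta_negative_near_0:
  assumes "\<delta> \<le> 0"
  shows "\<exists>c>0. \<exists>b>0. \<forall>x. 0 < x \<longrightarrow> x \<le> b \<longrightarrow> Ei_delta \<delta> x \<le> -c"
proof -
  let ?A = "Gamma (1 - \<delta>)"
  have A: "?A > 0" using assms by (intro Gamma_real_pos) auto
  have "((\<lambda>t. - (t powr (1 - \<delta> - 1) / exp t)) has_integral - ?A) {0<..}"
  proof (rule has_integral_neg)
    show "((\<lambda>t. t powr (1 - \<delta> - 1) / exp t) has_integral ?A) {0<..}"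
      using has_integral_spike_set_eq[of "{0..}" "{0<..}" "\<lambda>t. t powr (1 - \<delta> - 1) / exp t" ?A]
        Gamma_integral_real[of "1 - \<delta>"] assms
      by (fastforce intro: negligible_subset[of "{0}"])
  qed
  then have "((\<lambda>t. ei_integrand \<delta> (-t)) has_integral - ?A) {0<..}"
    by (rule has_integral_eq[rotated])
      (simp only: ei_integrand_neg greaterThan_iff, simp add: exp_minus field_simps)
  then have int_left: "integral {..<0} (ei_integrand \<delta>) = - ?A"
    using ei_integrand_left_0(2)[of \<delta>] assms by (auto intro: integral_unique)
  define b where "b = min 1 (?A / (2 * exp 1))"
  have b: "b > 0" "b \<le> 1" "exp 1 * b \<le> ?A / 2"
    using A by (auto simp: b_def min_def field_simps)
  have "Ei_delta \<delta> x \<le> - (?A / 2)" if x: "0 < x" "x \<le> b" for x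
  proof -
    have "integral ({..<0} \<union> {0..x}) (ei_integrand \<delta>)
        = integral {..<0} (ei_integrand \<delta>) + integral {0..x} (ei_integrand \<delta>)"
    proof (intro integral_Un set_lebesgue_integral_eq_integral(1))
      show "ei_integrand \<delta> absolutely_integrable_on {0..x}"
        using Ei_delta_less_1(1)[of \<delta> x] assms x by (auto intro: set_integrable_subset)
      show "ei_integrand \<delta> absolutely_integrable_on {..<0}"
        using assms by (intro ei_integrand_left_0) auto
    qed (auto intro: negligible_subset[of "{}"])
    moreover have "{..<0} \<union> {0..x} = {..x}" using x by auto
    ultimately have "Ei_delta \<delta> x = - ?A + integral {0..x} (ei_integrand \<delta>)"
      using Ei_delta_less_1(2)[of \<delta> x] assms x int_left by simp
    also have "integral {0..x} (ei_integrand \<delta>) \<le> integral {0..x} (\<lambda>t. exp 1)"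
    proof (rule integral_le)
      show "ei_integrand \<delta> integrable_on {0..x}"
        using Ei_delta_less_1(1)[of \<delta> x] assms x
        by (auto intro!: set_lebesgue_integral_eq_integral(1) intro: set_integrable_subset)
      fix t assume t: "t \<in> {0..x}"
      show "ei_integrand \<delta> t \<le> exp 1"
      proof (cases "t = 0")
        case False
        then have "exp t * t powr (-\<delta>) \<le> exp 1 * 1"
          using t x b assms powr_mono2[of "-\<delta>" t 1] by (intro mult_mono) auto
        then show ?thesis using False t by (simp add: ei_integrand_pos)
      qed (simp add: ei_integrand_def signed_powr_def)
    qed auto
    also have "integral {0..x} (\<lambda>t. exp 1 :: real) = exp 1 * x" using x by simp
    also have "\<dots> \<le> exp 1 * b" using x by simp
    finally show ?thesis using b by linarith
  qed
  then show ?thesis using A b by (intro exI[of _ "?A / 2"] conjI exI[of _ b]) auto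
qed

section \<open>Size of the radial function\<close>

lemma phi_eq:
  fixes x :: "real ^ 'n"
  assumes "x \<noteq> 0"
  shows "phi x = norm x powr (2 - real CARD('n)) * exp (- ((norm x)\<^sup>2 / 2)) *
    Ei_delta (2 - CARD('n) / 2) ((norm x)\<^sup>2 / 2)"
  using assms powr_real_of_int'[of "norm x" "2 - int CARD('n)"] by (simp add: phi_def Let_def)

text \<open>The exponents match, \<open>norm x powr (2 - d) = 2 powr \<delta> * norm x powr (-2) * s powr \<delta>\<close> for
\<open>s = (norm x)\<^sup>2 / 2\<close>, so that the last factor is the quantity that tends to 1 at infinity.\<close>

lemma phi_eq_scaled:
  fixes x :: "real ^ 'n"
  defines "\<delta> \<equiv> 2 - real CARD('n) / 2"
  assumes "x \<noteq> 0"
  shows "phi x = 2 powr \<delta> * norm x powr (-2) *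
    (exp (- ((norm x)\<^sup>2 / 2)) * ((norm x)\<^sup>2 / 2) powr \<delta> * Ei_delta \<delta> ((norm x)\<^sup>2 / 2))"
proof -
  have "(norm x)\<^sup>2 = norm x powr 2"
    using assms by simp
  then have "((norm x)\<^sup>2) powr \<delta> = norm x powr (2 * \<delta>)"
    by (simp only: powr_powr)
  then have "2 powr \<delta> * ((norm x)\<^sup>2 / 2) powr \<delta> = norm x powr (2 * \<delta>)"
    by (simp add: powr_divide)
  moreover have "norm x powr (2 * \<delta>) * norm x powr (-2) = norm x powr (2 - real CARD('n))"
    by (simp add: \<delta>_def algebra_simps flip: powr_add)
  ultimately have "norm x powr (2 - real CARD('n)) = 2 powr \<delta> * norm x powr (-2) * ((norm x)\<^sup>2 / 2) powr \<delta>"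
    by (metis mult.assoc mult.commute)
  then show ?thesis
    using phi_eq[OF assms(2)] by (simp add: \<delta>_def)
qed

lemma borel_measurable_phi [measurable]: "(phi :: real ^ 'n \<Rightarrow> real) \<in> borel_measurable borel"
proof (rule borel_measurable_continuous_countable_exceptions[where X = "{0}"])
  let ?F = "\<lambda>x::real^'n. norm x powr (2 - real CARD('n)) * exp (- ((norm x)\<^sup>2 / 2)) *
    Ei_delta (2 - CARD('n) / 2) ((norm x)\<^sup>2 / 2)"
  have "continuous_on (- {0}) ?F"
    by (intro continuous_intros continuous_on_compose2[OF continuous_on_Ei_delta]) auto
  then show "continuous_on (- {0}) (phi :: real ^ 'n \<Rightarrow> real)"
    by (rule continuous_on_cong[THEN iffD1, rotated -1]) (auto simp: phi_eq)
qed simp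

lemma borel_measurable_lebesgue_phi: "(phi :: real ^ 'n \<Rightarrow> real) \<in> borel_measurable lebesgue"
  using borel_measurable_phi by (intro measurable_completion) simp

lemma phi_upper_far:
  "\<exists>B. \<forall>x::real^'n. norm x \<ge> 1 \<longrightarrow> \<bar>phi x\<bar> \<le> B * norm x powr (-2)"
proof -
  define \<delta> where "\<delta> = 2 - real CARD('n) / 2"
  obtain C where C: "\<And>s. s \<ge> 1/2 \<Longrightarrow> \<bar>exp (-s) * s powr \<delta> * Ei_delta \<delta> s\<bar> \<le> C"
    using Ei_delta_bound_away_from_0[of \<delta> "1/2"] by (auto simp: \<delta>_def)
  have "\<bar>phi x\<bar> \<le> (2 powr \<delta> * C) * norm x powr (-2)" if "norm x \<ge> 1" for x :: "real^'n"
  proof -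
    let ?s = "(norm x)\<^sup>2 / 2"
    have "x \<noteq> 0" "?s \<ge> 1/2"
      using that one_le_power[of "norm x" 2] by auto
    then have "\<bar>phi x\<bar> = 2 powr \<delta> * norm x powr (-2) * \<bar>exp (-?s) * ?s powr \<delta> * Ei_delta \<delta> ?s\<bar>"
      using phi_eq_scaled[of x] by (simp add: \<delta>_def abs_mult)
    also have "\<dots> \<le> 2 powr \<delta> * norm x powr (-2) * C"
      using C[OF \<open>?s \<ge> 1/2\<close>] by (intro mult_left_mono) auto
    finally show ?thesis by (simp add: mult_ac)
  qed
  then show ?thesis by blast
qed

lemma phi_upper_near:
  assumes "\<sigma> > 0" "2 - real CARD('n) / 2 \<le> \<sigma> + 1"
  shows "\<exists>A. \<forall>x::real^'n. x \<noteq> 0 \<longrightarrow> norm x \<le> 1 \<longrightarrow>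
    \<bar>phi x\<bar> \<le> A * norm x powr (- (real CARD('n) - 2 + 2 * \<sigma>))"
proof -
  define \<delta> where "\<delta> = 2 - real CARD('n) / 2"
  obtain C where C: "\<And>s. 0 < s \<Longrightarrow> s \<le> 1 \<Longrightarrow> \<bar>Ei_delta \<delta> s\<bar> \<le> C * s powr (-\<sigma>)"
    using Ei_delta_bound_near_0[of \<delta> \<sigma>] assms by (auto simp: \<delta>_def)
  have "\<bar>phi x\<bar> \<le> (C * 2 powr \<sigma>) * norm x powr (- (real CARD('n) - 2 + 2 * \<sigma>))"
    if x: "x \<noteq> 0" "norm x \<le> 1" for x :: "real^'n"
  proof -
    let ?s = "(norm x)\<^sup>2 / 2"
    have s: "0 < ?s" "?s \<le> 1"
      using x power_le_one[of "norm x" 2] by auto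
    have "(norm x)\<^sup>2 = norm x powr 2"
      using x by simp
    then have "((norm x)\<^sup>2) powr (-\<sigma>) = norm x powr (2 * (-\<sigma>))"
      by (simp only: powr_powr)
    then have s_powr: "?s powr (-\<sigma>) = 2 powr \<sigma> * norm x powr (- 2 * \<sigma>)"
      by (simp add: powr_divide powr_minus field_simps)
    have "\<bar>phi x\<bar> = norm x powr (2 - real CARD('n)) * (exp (-?s) * \<bar>Ei_delta \<delta> ?s\<bar>)"
      using phi_eq[OF x(1)] by (simp add: \<delta>_def abs_mult)
    also have "\<dots> \<le> norm x powr (2 - real CARD('n)) * (1 * (C * ?s powr (-\<sigma>)))"
      using s C[OF s] by (intro mult_left_mono mult_mono) auto
    also have "\<dots> = (C * 2 powr \<sigma>) * (norm x powr (2 - real CARD('n)) * norm x powr (- 2 * \<sigma>))"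
      unfolding s_powr by simp
    also have "norm x powr (2 - real CARD('n)) * norm x powr (- 2 * \<sigma>) =
        norm x powr (- (real CARD('n) - 2 + 2 * \<sigma>))"
      by (simp add: algebra_simps flip: powr_add)
    finally show ?thesis .
  qed
  then show ?thesis by blast
qed

lemma phi_lower_far:
  "\<exists>c>0. \<exists>R\<ge>1. \<forall>x::real^'n. norm x \<ge> R \<longrightarrow> c * norm x powr (-2) \<le> \<bar>phi x\<bar>"
proof -
  define \<delta> where "\<delta> = 2 - real CARD('n) / 2"
  have "\<delta> < 2" by (simp add: \<delta>_def)
  then have "\<forall>\<^sub>F s in at_top. exp (-s) * s powr \<delta> * Ei_delta \<delta> s > 1/2"
    using order_tendstoD(1)[OF Ei_delta_asymptotics, of \<delta> "1/2"] by simp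
  then obtain S where S: "\<And>s. s \<ge> S \<Longrightarrow> exp (-s) * s powr \<delta> * Ei_delta \<delta> s > 1/2"
    by (auto simp: eventually_at_top_linorder)
  define R where "R = max 1 (2 * S)"
  have "2 powr \<delta> / 2 * norm x powr (-2) \<le> \<bar>phi x\<bar>" if R: "norm x \<ge> R" for x :: "real^'n"
  proof -
    let ?s = "(norm x)\<^sup>2 / 2"
    have "R * 1 \<le> norm x * norm x"
      using R by (intro mult_mono) (auto simp: R_def)
    then have "x \<noteq> 0" "?s \<ge> S"
      using R by (auto simp: power2_eq_square R_def)
    have "2 powr \<delta> * norm x powr (-2) * (1/2)
        \<le> 2 powr \<delta> * norm x powr (-2) * (exp (-?s) * ?s powr \<delta> * Ei_delta \<delta> ?s)"
      using S[OF \<open>?s \<ge> S\<close>] by (intro mult_left_mono) auto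
    also have "\<dots> = phi x"
      using phi_eq_scaled[OF \<open>x \<noteq> 0\<close>] by (simp add: \<delta>_def)
    finally show ?thesis by simp
  qed
  moreover have "R \<ge> 1" by (simp add: R_def)
  ultimately show ?thesis
    by (intro exI[of _ "2 powr \<delta> / 2"] conjI exI[of _ R]) auto
qed

lemma phi_lower_near:
  assumes "CARD('n) \<ge> 4"
  shows "\<exists>c>0. \<exists>b>0. b \<le> 1 \<and> (\<forall>x::real^'n. norm x \<in> {0<..b} \<longrightarrow>
    c * norm x powr (- (real CARD('n) - 2)) \<le> \<bar>phi x\<bar>)"
proof -
  define \<delta> where "\<delta> = 2 - real CARD('n) / 2"
  have "\<delta> \<le> 0" using assms by (simp add: \<delta>_def)
  then obtain c s0 where c: "c > 0" and s0: "s0 > 0"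
    and Ei: "\<And>s. 0 < s \<Longrightarrow> s \<le> s0 \<Longrightarrow> Ei_delta \<delta> s \<le> -c"
    using Ei_delta_negative_near_0[of \<delta>] by blast
  define b where "b = min 1 s0"
  have b: "b > 0" "b \<le> 1" using s0 by (auto simp: b_def)
  have "exp (-1) * c * norm x powr (- (real CARD('n) - 2)) \<le> \<bar>phi x\<bar>"
    if x: "norm x \<in> {0<..b}" for x :: "real^'n"
  proof -
    let ?s = "(norm x)\<^sup>2 / 2"
    have x0: "x \<noteq> 0" using x by auto
    have "norm x * norm x \<le> 1 * b"
      using x b by (intro mult_mono) auto
    then have s: "0 < ?s" "?s \<le> s0" "?s \<le> 1"
      using x0 s0 by (auto simp: power2_eq_square b_def)
    have "exp (-1) * c \<le> exp (-?s) * \<bar>Ei_delta \<delta> ?s\<bar>"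
      using s c Ei[OF s(1,2)] by (intro mult_mono) auto
    then have "norm x powr (2 - real CARD('n)) * (exp (-1) * c)
        \<le> norm x powr (2 - real CARD('n)) * (exp (-?s) * \<bar>Ei_delta \<delta> ?s\<bar>)"
      by (intro mult_left_mono) auto
    also have "\<dots> = \<bar>phi x\<bar>"
      using phi_eq[OF x0] by (simp add: \<delta>_def abs_mult)
    finally show ?thesis by (simp add: mult_ac)
  qed
  then show ?thesis
    using b c by (intro exI[of _ "exp (-1) * c"] conjI exI[of _ b]) auto
qed

section \<open>Lebesgue spaces\<close>

text \<open>Here \<open>\<delta> = 3 / 2\<close>, and \<open>\<sigma> = 1 / 2\<close> is the smallest admissible choice: the factor \<open>norm x\<close>
cancels the singularity of \<open>Ei_delta\<close> completely.\<close>

lemma integrable_phi_dim_1: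
  assumes "CARD('n) = 1"
  shows "integrable lebesgue (phi :: real ^ 'n \<Rightarrow> real)"
proof -
  obtain A where A: "\<And>x::real^'n. x \<noteq> 0 \<Longrightarrow> norm x \<le> 1 \<Longrightarrow> \<bar>phi x\<bar> \<le> A * norm x powr (-0)"
    using phi_upper_near[where 'n = 'n, of "1/2"] assms by auto
  obtain B where B: "\<And>x::real^'n. norm x \<ge> 1 \<Longrightarrow> \<bar>phi x\<bar> \<le> B * norm x powr (-2)"
    using phi_upper_far[where 'n = 'n] by auto
  show ?thesis
    using assms A B by (intro integrable_norm_powr_dominated[where a = 0 and b = 2 and A = A and B = B]) auto
qed

text \<open>With \<open>\<sigma> = 1 / 8\<close> the square is bounded near the origin by a multiple of
\<open>norm x powr (- (2 * d - 4 + 1 / 2))\<close>, which is integrable for \<open>d < 7 / 2\<close>; at infinity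
\<open>norm x powr (-4)\<close> is integrable for \<open>d < 4\<close>.\<close>

lemma in_L2_phi_dim_2_3:
  assumes "CARD('n) = 2 \<or> CARD('n) = 3"
  shows "in_Lp lebesgue 2 (phi :: real ^ 'n \<Rightarrow> real)"
proof -
  define a where "a = real CARD('n) - 2 + 1/4"
  obtain A where A: "\<And>x::real^'n. x \<noteq> 0 \<Longrightarrow> norm x \<le> 1 \<Longrightarrow> \<bar>phi x\<bar> \<le> A * norm x powr (-a)"
  proof -
    have "real CARD('n) \<ge> 2" using assms by auto
    then have "\<exists>A. \<forall>x::real^'n. x \<noteq> 0 \<longrightarrow> norm x \<le> 1 \<longrightarrow> \<bar>phi x\<bar> \<le> A * norm x powr (-a)"
      using phi_upper_near[where 'n = 'n, of "1/8"] by (simp add: a_def)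
    then show ?thesis using that by blast
  qed
  obtain B where B: "\<And>x::real^'n. norm x \<ge> 1 \<Longrightarrow> \<bar>phi x\<bar> \<le> B * norm x powr (-2)"
    using phi_upper_far[where 'n = 'n] by auto
  have "integrable lebesgue (\<lambda>x::real^'n. (phi x)\<^sup>2)"
  proof (rule integrable_norm_powr_dominated[where a = "2 * a" and b = 4 and A = "A\<^sup>2" and B = "B\<^sup>2"])
    have sq: "(C * norm x powr (-t))\<^sup>2 = C\<^sup>2 * norm x powr (- (2 * t))" for x :: "real^'n" and C t :: real
      by (simp add: power_mult_distrib power2_eq_square flip: powr_add)
    show "norm ((phi x)\<^sup>2) \<le> A\<^sup>2 * norm x powr (- (2 * a))" if "x \<noteq> 0" "norm x \<le> 1" for x :: "real^'n"
      using power_mono[OF A[OF that], of 2] sq[of A x a] by simp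
    show "norm ((phi x)\<^sup>2) \<le> B\<^sup>2 * norm x powr (- 4)" if "norm x \<ge> 1" for x :: "real^'n"
      using power_mono[OF B[OF that], of 2] sq[of B x 2] by simp
  qed (use assms in \<open>auto simp: a_def\<close>)
  then show ?thesis
    by (simp add: in_Lp_def borel_measurable_lebesgue_phi)
qed

text \<open>For \<open>norm x \<ge> 1\<close> the decay \<open>norm x powr (-2 * q)\<close> is no faster than the critical one, since
\<open>2 * q \<le> 4 \<le> d\<close>.\<close>

lemma not_integrable_phi_powr_at_infinity:
  assumes "CARD('n) \<ge> 4" "1 \<le> q" "q \<le> 2"
  shows "\<not> integrable lebesgue (\<lambda>x::real^'n. \<bar>phi x\<bar> powr q)"
proof -
  obtain c R where c: "c > 0" and R: "R \<ge> 1"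
    and phi: "\<And>x::real^'n. norm x \<ge> R \<Longrightarrow> c * norm x powr (-2) \<le> \<bar>phi x\<bar>"
    using phi_lower_far[where 'n = 'n] by blast
  show ?thesis
  proof (rule not_integrable_norm_powr_DIM[where I = "{R..}" and c = "c powr q"])
    show "c powr q * norm x powr (- real DIM(real^'n)) \<le> norm (\<bar>phi x\<bar> powr q)"
      if x: "norm x \<in> {R..}" for x :: "real^'n"
    proof -
      have "c powr q * norm x powr (- real CARD('n)) \<le> c powr q * norm x powr (- 2 * q)"
        using x R assms by (intro mult_left_mono powr_mono) auto
      also have "\<dots> = (c * norm x powr (-2)) powr q"
        using c by (simp only: powr_mult powr_powr)
      also have "\<dots> \<le> \<bar>phi x\<bar> powr q"
        using phi[of x] x c assms by (intro powr_mono2) auto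
      finally show ?thesis by simp
    qed
    show "\<exists>u>0. {u..u * exp K} \<subseteq> {R..}" for K
      using R by (intro exI[of _ R]) auto
  qed (use R c in auto)
qed

text \<open>The singularity \<open>norm x powr (- (d - 2) * q)\<close> is at least the critical one, since
\<open>(d - 2) * q \<ge> 2 * d - 4 \<ge> d\<close>. The localization to a ball makes the lemma applicable to an
essentially bounded function as well.\<close>

lemma not_integrable_phi_powr_at_0:
  assumes "CARD('n) \<ge> 4" "2 \<le> q"
  shows "\<exists>b. \<not> integrable lebesgue (\<lambda>x::real^'n. indicator (cball 0 b) x * \<bar>phi x\<bar> powr q)"
proof -
  obtain c b where c: "c > 0" and b: "0 < b" "b \<le> 1"
    and phi: "\<And>x::real^'n. norm x \<in> {0<..b} \<Longrightarrow> c * norm x powr (- (real CARD('n) - 2)) \<le> \<bar>phi x\<bar>"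
    using phi_lower_near[where 'n = 'n, OF assms(1)] by blast
  have "\<not> integrable lebesgue (\<lambda>x::real^'n. indicator (cball 0 b) x * \<bar>phi x\<bar> powr q)"
  proof (rule not_integrable_norm_powr_DIM[where I = "{0<..b}" and c = "c powr q"])
    show "c powr q * norm x powr (- real DIM(real^'n)) \<le> norm (indicator (cball 0 b) x * \<bar>phi x\<bar> powr q)"
      if x: "norm x \<in> {0<..b}" for x :: "real^'n"
    proof -
      have "(real CARD('n) - 2) * 2 \<le> (real CARD('n) - 2) * q"
        using assms by (intro mult_left_mono) auto
      then have "real CARD('n) \<le> (real CARD('n) - 2) * q"
        using of_nat_mono[OF assms(1), where 'a = real] by simp
      then have "c powr q * norm x powr (- real CARD('n)) \<le> c powr q * norm x powr (- (real CARD('n) - 2) * q)"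
        using x b by (intro mult_left_mono powr_mono') (auto simp: algebra_simps)
      also have "\<dots> = (c * norm x powr (- (real CARD('n) - 2))) powr q"
        using c by (simp only: powr_mult powr_powr)
      also have "\<dots> \<le> \<bar>phi x\<bar> powr q"
        using phi[OF x] c assms by (intro powr_mono2) auto
      finally show ?thesis using x by simp
    qed
    show "\<exists>u>0. {u..u * exp K} \<subseteq> {0<..b}" for K
    proof (intro exI conjI subsetI)
      show pos: "b * exp (-K) > 0" using b by simp
      fix r assume "r \<in> {b * exp (-K)..b * exp (-K) * exp K}"
      then show "r \<in> {0<..b}" using pos by (simp add: exp_minus mult.assoc)
    qed
  qed (use c in auto)
  then show ?thesis by blast
qed

text \<open>Finite exponents \<open>p \<le> 2\<close> fail at infinity and \<open>p > 2\<close> at the origin; for \<open>p = \<infinity>\<close>, a bounded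
function would be square integrable on balls, which is excluded at the origin.\<close>

lemma not_in_Lp_phi:
  assumes "CARD('n) \<ge> 4" "1 \<le> p"
  shows "\<not> in_Lp lebesgue p (phi :: real ^ 'n \<Rightarrow> real)"
proof
  assume Lp: "in_Lp lebesgue p (phi :: real ^ 'n \<Rightarrow> real)"
  show False
  proof (cases "p = \<infinity>")
    case True
    then obtain C where C: "AE x::real^'n in lebesgue. \<bar>phi x\<bar> \<le> C"
      using Lp by (auto simp: in_Lp_def)
    obtain b where b: "\<not> integrable lebesgue (\<lambda>x::real^'n. indicator (cball 0 b) x * \<bar>phi x\<bar> powr 2)"
      using not_integrable_phi_powr_at_0[OF assms(1), of 2] by auto
    have "integrable lebesgue (\<lambda>x::real^'n. indicator (cball 0 b) x * \<bar>phi x\<bar> powr 2)"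
    proof (rule Bochner_Integration.integrable_bound)
      show "integrable lebesgue (\<lambda>x::real^'n. indicator (cball 0 b) x * C powr 2)"
        using lmeasurable_cball[of "0::real^'n" b]
        by (intro integrable_mult_left integrable_real_indicator) (auto simp: fmeasurable_def)
      show "(\<lambda>x::real^'n. indicator (cball 0 b) x * \<bar>phi x\<bar> powr 2) \<in> borel_measurable lebesgue"
        using borel_measurable_lebesgue_phi
        by (intro borel_measurable_times borel_measurable_indicator powr_real_measurable
            borel_measurable_abs) auto
      show "AE x::real^'n in lebesgue. norm (indicator (cball 0 b) x * \<bar>phi x\<bar> powr 2)
          \<le> norm (indicator (cball 0 b) x * C powr 2 :: real)"
        using C by eventually_elim (auto split: split_indicator simp flip: abs_le_square_iff)
    qed
    with b show False by simp
  next
    case False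
    define q where "q = enn2real p"
    have "p = ennreal q"
      using False by (simp add: q_def less_top)
    then have q: "q \<ge> 1"
      using assms(2) by simp
    have int: "integrable lebesgue (\<lambda>x::real^'n. \<bar>phi x\<bar> powr q)"
      using Lp False by (simp add: in_Lp_def q_def)
    show False
    proof (cases "q \<le> 2")
      case True
      then show False
        using not_integrable_phi_powr_at_infinity[OF assms(1) q] int by blast
    next
      case False
      then obtain b where b: "\<not> integrable lebesgue (\<lambda>x::real^'n. indicator (cball 0 b) x * \<bar>phi x\<bar> powr q)"
        using not_integrable_phi_powr_at_0[OF assms(1), of q] by auto
      have "integrable lebesgue (\<lambda>x::real^'n. indicator (cball 0 b) x *\<^sub>R \<bar>phi x\<bar> powr q)"
        using int by (intro integrable_mult_indicator) auto
      with b show False by simp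
    qed
  qed
qed

section \<open>Tempered distributions\<close>

lemma schwartz_bound:
  fixes f :: "real ^ 'n \<Rightarrow> complex"
  assumes "bdd_above (range (\<lambda>x. (1 + (norm x)\<^sup>2) ^ N * norm (iter_partial [] f x)))"
  shows "norm (f x) \<le> schwartz_seminorm N [] f / (1 + (norm x)\<^sup>2) ^ N"
proof -
  have "(1 + (norm x)\<^sup>2) ^ N * norm (iter_partial [] f x) \<le> schwartz_seminorm N [] f"
    unfolding schwartz_seminorm_def by (rule cSUP_upper[OF _ assms]) simp
  moreover have "(1 + (norm x)\<^sup>2) ^ N > 0"
    by (intro zero_less_power add_pos_nonneg) auto
  ultimately show ?thesis
    by (simp add: iter_partial_def field_simps)
qed

lemma schwartz_borel_measurable:
  assumes "f \<in> schwartz"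
  shows "f \<in> borel_measurable borel"
proof (rule borel_measurable_continuous_onI)
  have "f differentiable (at x)" for x
    using assms by (auto simp: schwartz_def smooth_def iter_partial_def dest: spec[of _ "[]"])
  then show "continuous_on UNIV f"
    by (intro continuous_at_imp_continuous_on) (auto intro: differentiable_imp_continuous_within)
qed

lemma schwartz_bdd:
  "f \<in> schwartz \<Longrightarrow> bdd_above (range (\<lambda>x. (1 + (norm x)\<^sup>2) ^ N * norm (iter_partial ks f x)))"
  by (simp add: schwartz_def)

lemma schwartz_bdd_diff:
  assumes "f \<in> schwartz" "g \<in> schwartz"
  shows "bdd_above (range (\<lambda>x. (1 + (norm x)\<^sup>2) ^ N * norm (iter_partial [] (\<lambda>x. g x - f x) x)))"
proof -
  obtain F where F: "\<And>x. (1 + (norm x)\<^sup>2) ^ N * norm (f x) \<le> F"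
    using schwartz_bdd[OF assms(1), of N "[]"] unfolding bdd_above_def iter_partial_def by auto
  obtain G where G: "\<And>x. (1 + (norm x)\<^sup>2) ^ N * norm (g x) \<le> G"
    using schwartz_bdd[OF assms(2), of N "[]"] unfolding bdd_above_def iter_partial_def by auto
  have "(1 + (norm x)\<^sup>2) ^ N * norm (g x - f x) \<le> G + F" for x
  proof -
    have "(1 + (norm x)\<^sup>2) ^ N * norm (g x - f x) \<le> (1 + (norm x)\<^sup>2) ^ N * (norm (g x) + norm (f x))"
      by (intro mult_left_mono norm_triangle_ineq4) auto
    also have "\<dots> \<le> G + F"
      using F[of x] G[of x] by (simp add: distrib_left)
    finally show ?thesis .
  qed
  then show ?thesis
    by (intro bdd_aboveI[of _ "G + F"]) (auto simp: iter_partial_def)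
qed

text \<open>A function that becomes integrable after division by \<open>(1 + (norm x)\<^sup>2) ^ N\<close> is tempered: the
pairing with \<open>f\<close> is bounded by a constant times the seminorm of \<open>f\<close> for \<open>N\<close> and the empty list of
derivatives, so seminorm balls witness continuity.\<close>

lemma tempered_distribution_of_weight:
  fixes w :: "real ^ 'n \<Rightarrow> real"
  assumes w: "w \<in> borel_measurable lebesgue"
    and int: "integrable lebesgue (\<lambda>x. w x / (1 + (norm x)\<^sup>2) ^ N)"
  shows "\<forall>f\<in>schwartz. integrable lebesgue (\<lambda>x. complex_of_real (w x) * f x)"
    and "tempered_distribution (\<lambda>f. LINT x|lebesgue. complex_of_real (w x) * f x)"
proof -
  let ?W = "\<lambda>x. \<bar>w x / (1 + (norm x)\<^sup>2) ^ N\<bar>"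
  let ?T = "\<lambda>f. LINT x|lebesgue. complex_of_real (w x) * f x"
  have int_W: "integrable lebesgue ?W"
    using int by (rule integrable_abs)
  have dom: "norm (complex_of_real (w x) * f x) \<le> schwartz_seminorm N [] f * ?W x"
    if "bdd_above (range (\<lambda>x. (1 + (norm x)\<^sup>2) ^ N * norm (iter_partial [] f x)))" for f x
    using mult_left_mono[OF schwartz_bound[OF that, of x], of "\<bar>w x\<bar>"]
    by (simp add: norm_mult abs_divide mult_ac)
  show int_f: "\<forall>f\<in>schwartz. integrable lebesgue (\<lambda>x. complex_of_real (w x) * f x)"
  proof
    fix f :: "real ^ 'n \<Rightarrow> complex" assume f: "f \<in> schwartz"
    note dom = dom[OF schwartz_bdd[OF f]]
    have [measurable]: "f \<in> borel_measurable lebesgue"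
      using schwartz_borel_measurable[OF f] by (intro measurable_completion) simp
    show "integrable lebesgue (\<lambda>x. complex_of_real (w x) * f x)"
    proof (rule Bochner_Integration.integrable_bound)
      show "integrable lebesgue (\<lambda>x. schwartz_seminorm N [] f * ?W x)"
        using int_W by (rule integrable_mult_right)
      show "(\<lambda>x. complex_of_real (w x) * f x) \<in> borel_measurable lebesgue"
        using w by measurable
      show "AE x in lebesgue. norm (complex_of_real (w x) * f x) \<le> norm (schwartz_seminorm N [] f * ?W x)"
        using dom by (intro AE_I2) (metis abs_ge_self order_trans real_norm_def)
    qed
  qed
  have T_diff: "norm (?T g - ?T f) \<le> schwartz_seminorm N [] (\<lambda>x. g x - f x) * (LINT x|lebesgue. ?W x)"
    if fg: "f \<in> schwartz" "g \<in> schwartz" for f g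
  proof -
    have "?T g - ?T f = (LINT x|lebesgue. complex_of_real (w x) * (g x - f x))"
      using int_f fg by (simp add: right_diff_distrib)
    also have "norm \<dots> \<le> (LINT x|lebesgue. schwartz_seminorm N [] (\<lambda>x. g x - f x) * ?W x)"
    proof (rule Bochner_Integration.integral_norm_bound_integral)
      show "integrable lebesgue (\<lambda>x. complex_of_real (w x) * (g x - f x))"
        using int_f fg by (simp add: right_diff_distrib)
      show "integrable lebesgue (\<lambda>x. schwartz_seminorm N [] (\<lambda>x. g x - f x) * ?W x)"
        using int_W by (rule integrable_mult_right)
    qed (rule dom[OF schwartz_bdd_diff[OF fg]])
    also have "\<dots> = schwartz_seminorm N [] (\<lambda>x. g x - f x) * (LINT x|lebesgue. ?W x)"
      by (rule integral_mult_right_zero)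
    finally show ?thesis .
  qed
  have topspace: "topspace (schwartz_topology :: (real ^ 'n \<Rightarrow> complex) topology) \<subseteq> schwartz"
    unfolding schwartz_topology_def topology_generated_by_topspace by blast
  have "continuous_map schwartz_topology euclidean ?T"
    unfolding continuous_map
  proof (intro conjI allI impI)
    fix U :: "complex set" assume "openin euclidean U"
    then have U: "open U" by simp
    show "openin schwartz_topology {f \<in> topspace schwartz_topology. ?T f \<in> U}"
    proof (subst openin_subopen, intro ballI)
      fix f assume "f \<in> {f \<in> topspace schwartz_topology. ?T f \<in> U}"
      then have f: "f \<in> schwartz" "?T f \<in> U"
        using topspace by auto
      obtain e where e: "e > 0" "\<And>z. dist z (?T f) < e \<Longrightarrow> z \<in> U"
        using U f(2) by (auto simp: open_dist)
      define I where "I = (LINT x|lebesgue. ?W x)"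
      have I: "I \<ge> 0" by (simp add: I_def)
      \<comment> \<open>The summand 1 allows for \<open>I = 0\<close>.\<close>
      define \<epsilon> where "\<epsilon> = e / (I + 1)"
      have \<epsilon>: "\<epsilon> > 0" using e I by (simp add: \<epsilon>_def)
      let ?B = "{g \<in> schwartz. schwartz_seminorm N [] (\<lambda>x. g x - f x) < \<epsilon>}"
      have B: "openin schwartz_topology ?B"
        unfolding schwartz_topology_def using f \<epsilon> by (intro topology_generated_by_Basis) blast
      moreover have "f \<in> ?B"
        using f \<epsilon> by (simp add: schwartz_seminorm_def iter_partial_def)
      moreover have "?T g \<in> U" if g: "g \<in> ?B" for g
      proof (rule e(2))
        have "dist (?T g) (?T f) \<le> schwartz_seminorm N [] (\<lambda>x. g x - f x) * I"
          unfolding dist_norm I_def using g f by (intro T_diff) auto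
        also have "\<dots> \<le> \<epsilon> * I"
          using g I by (intro mult_right_mono) auto
        also have "\<dots> < e"
          using e I by (simp add: \<epsilon>_def field_simps)
        finally show "dist (?T g) (?T f) < e" .
      qed
      ultimately show "\<exists>B. openin schwartz_topology B \<and> f \<in> B \<and>
          B \<subseteq> {f \<in> topspace schwartz_topology. ?T f \<in> U}"
        by (intro exI[of _ ?B]) (auto dest: openin_subset)
    qed
  qed auto
  moreover have "?T (\<lambda>x. f x + g x) = ?T f + ?T g" if "f \<in> schwartz" "g \<in> schwartz" for f g
    using int_f that by (simp add: distrib_left)
  moreover have "?T (\<lambda>x. c * f x) = c * ?T f" for c f
    by (simp add: mult.left_commute)
  ultimately show "tempered_distribution ?T"
    unfolding tempered_distribution_def by blast
qed

text \<open>The exponent \<open>CARD('n)\<close> is merely large enough: together with the decay of \<open>phi\<close> it yields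
\<open>norm x powr (- (2 + 2 * d))\<close> at infinity.\<close>

lemma integrable_phi_weighted:
  assumes "CARD('n) \<ge> 4"
  shows "integrable lebesgue (\<lambda>x::real^'n. phi x / (1 + (norm x)\<^sup>2) ^ CARD('n))"
proof -
  let ?d = "CARD('n)"
  define a where "a = real ?d - 2 + 1/4"
  obtain A where A: "\<And>x::real^'n. x \<noteq> 0 \<Longrightarrow> norm x \<le> 1 \<Longrightarrow> \<bar>phi x\<bar> \<le> A * norm x powr (-a)"
  proof -
    have "real CARD('n) \<ge> 2" using assms by auto
    then have "\<exists>A. \<forall>x::real^'n. x \<noteq> 0 \<longrightarrow> norm x \<le> 1 \<longrightarrow> \<bar>phi x\<bar> \<le> A * norm x powr (-a)"
      using phi_upper_near[where 'n = 'n, of "1/8"] by (simp add: a_def)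
    then show ?thesis using that by blast
  qed
  obtain B where B: "\<And>x::real^'n. norm x \<ge> 1 \<Longrightarrow> \<bar>phi x\<bar> \<le> B * norm x powr (-2)"
    using phi_upper_far[where 'n = 'n] by auto
  show ?thesis
  proof (rule integrable_norm_powr_dominated[where a = a and b = "2 + 2 * real ?d" and A = A and B = B])
    fix x :: "real^'n"
    have ge1: "1 \<le> (1 + (norm x)\<^sup>2) ^ ?d"
      by (intro one_le_power) auto
    show "norm (phi x / (1 + (norm x)\<^sup>2) ^ ?d) \<le> A * norm x powr (-a)" if "x \<noteq> 0" "norm x \<le> 1"
    proof -
      have "\<bar>phi x\<bar> / (1 + (norm x)\<^sup>2) ^ ?d \<le> \<bar>phi x\<bar> / 1"
        using ge1 by (intro divide_left_mono) (auto simp del: zero_less_power_eq intro: less_le_trans[OF zero_less_one])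
      then show ?thesis
        using A[OF that] by simp
    qed
    show "norm (phi x / (1 + (norm x)\<^sup>2) ^ ?d) \<le> B * norm x powr (- (2 + 2 * real ?d))" if x: "norm x \<ge> 1"
    proof -
      have pos: "norm x > 0" "(1 + (norm x)\<^sup>2) ^ ?d > 0" using x ge1 by linarith+
      have "norm x powr (2 * real ?d) = ((norm x)\<^sup>2) ^ ?d"
        using pos powr_realpow[of "norm x" "2 * ?d"] by (simp add: power_mult)
      also have "\<dots> \<le> (1 + (norm x)\<^sup>2) ^ ?d"
        by (intro power_mono) auto
      finally have "\<bar>phi x\<bar> / (1 + (norm x)\<^sup>2) ^ ?d \<le> \<bar>phi x\<bar> / norm x powr (2 * real ?d)"
        using pos by (intro divide_left_mono mult_pos_pos) auto
      also have "\<dots> \<le> B * norm x powr (-2) / norm x powr (2 * real ?d)"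
        using B[OF x] by (intro divide_right_mono) auto
      also have "\<dots> = B * norm x powr (- (2 + 2 * real ?d))"
        using powr_diff[of "norm x" "-2" "2 * real ?d"] by simp
      finally show ?thesis by simp
    qed
  qed (auto simp: a_def)
qed

theorem mainTheorem2:
  shows "(CARD('n::finite) = 1 \<longrightarrow> integrable lebesgue (phi :: real ^ 'n \<Rightarrow> real)) \<and>
    (CARD('n) = 2 \<or> CARD('n) = 3 \<longrightarrow> in_Lp lebesgue 2 (phi :: real ^ 'n \<Rightarrow> real)) \<and>
    (CARD('n) \<ge> 4 \<longrightarrow>
      (\<forall>p::ennreal. 1 \<le> p \<longrightarrow> \<not> in_Lp lebesgue p (phi :: real ^ 'n \<Rightarrow> real)) \<and>
      (\<forall>\<phi> \<in> (schwartz :: (real ^ 'n \<Rightarrow> complex) set).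
         integrable lebesgue (\<lambda>x. complex_of_real (phi x) * \<phi> x)) \<and>
      tempered_distribution
        (\<lambda>\<phi> :: real ^ 'n \<Rightarrow> complex. LINT x|lebesgue. complex_of_real (phi x) * \<phi> x))"
  using integrable_phi_dim_1 in_L2_phi_dim_2_3 not_in_Lp_phi
    tempered_distribution_of_weight[OF borel_measurable_lebesgue_phi integrable_phi_weighted]
  by blast

end
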